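(* $CAN(3\text{-}QI(11,2),2)=11$.
   Context: The hypergraph $3\text{-}QI(n,2)$ is the $3$-uniform hypergraph whose vertices are all partitions $\{P,\overline{P}\}$ of $\{1,\dots,n\}$ into two classes, each class of size at least $4$. Three distinct vertices $\{P,\overline P\},\{Q,\overline Q\},\{R,\overline R\}$ form a hyperedge if and only if all eight intersections $P'\cap Q'\cap R'$ with $P'\in\{P,\overline P\}$, $Q'\in\{Q,\overline Q\}$, $R'\in\{R,\overline R\}$ are nonempty. For a hypergraph $H=(V,E)$ and positive integers $n,g$, a covering array $CA(n,H,g)$ is an $n\times|V|$ array with entries from a fixed set $S$ of size $g$, with columns indexed by $V$, such that for every hyperedge $e\in E$ the $n\times|e|$ subarray on the columns of $e$ contains every ordered $|e|$-tuple from $S^{|e|}$ at least once as a row. $CAN(H,g)$ is the minimum $n$ for which a $CA(n,H,g)$ exists. *)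

theory Defs
  imports Main "HOL-Library.FuncSet" "HOL-Library.Disjoint_Sets"
begin

record 'v hypergraph =
  hverts :: "'v set"
  hedges :: "'v set set"

definition QI3_verts :: "nat \<Rightarrow> nat set set set" where
  "QI3_verts n = {X. partition_on {1..n} X \<and> card X = 2 \<and> (\<forall>P\<in>X. 4 \<le> card P)}"

definition QI3 :: "nat \<Rightarrow> nat set set hypergraph" where
  "QI3 n = \<lparr> hverts = QI3_verts n,
     hedges = {{X, Y, Z} | X Y Z.
       X \<in> QI3_verts n \<and> Y \<in> QI3_verts n \<and> Z \<in> QI3_verts n \<and>
       X \<noteq> Y \<and> X \<noteq> Z \<and> Y \<noteq> Z \<and>
       (\<forall>P\<in>X. \<forall>Q\<in>Y. \<forall>R\<in>Z. P \<inter> Q \<inter> R \<noteq> {})} \<rparr>"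

text \<open>
  The array is a function of a row index below \<open>n\<close> and a column index in the vertex set.
  An ordered tuple over \<open>S\<close> on the columns of a hyperedge \<open>e\<close> is a function in
  \<open>e \<rightarrow>\<^sub>E S\<close>, which makes a choice of ordering of \<open>e\<close> unnecessary.
\<close>

definition covering_array ::
  "'s set \<Rightarrow> nat \<Rightarrow> 'v hypergraph \<Rightarrow> (nat \<Rightarrow> 'v \<Rightarrow> 's) \<Rightarrow> bool" where
  "covering_array S n H A \<longleftrightarrow>
     (\<forall>i<n. \<forall>v\<in>hverts H. A i v \<in> S) \<and>
     (\<forall>e\<in>hedges H. \<forall>t\<in>e \<rightarrow>\<^sub>E S. \<exists>i<n. \<forall>v\<in>e. A i v = t v)"

text \<open>
  Whether a covering array exists depends only on the size of the symbol set, so the symbol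
  set of size \<open>g\<close> is fixed to be \<open>{..<g}\<close>.
\<close>

definition CAN :: "'v hypergraph \<Rightarrow> nat \<Rightarrow> nat" where
  "CAN H g = (LEAST n. 0 < n \<and> (\<exists>A. covering_array {..<g} n H A))"

end

theory Submission
  imports Defs
begin

text \<open>
  The array whose rows are the points of \<open>{1..n}\<close>, a row recording the class in which its point
  lies, is a covering array by the very definition of a hyperedge. This gives at most 11 rows.

  For the lower bound it is enough to look at six vertices \<open>a, b, c, t, u, w\<close> of the hypergraph
  that span the hyperedge \<open>tuw\<close> and all four triples of each of \<open>abct\<close>, \<open>abcu\<close>, \<open>abcw\<close>.
  Let a two-symbol array with at most ten rows cover these triples.

  Consider \<open>abct\<close> first. The vertices of the 4-cube that do not occur as rows are pairwise
  non-adjacent, and there are at least six of them. An independent set of the 4-cube that meets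
  both parity classes has at most five elements, so one parity class consists of rows only
  (\<open>parity_class_covered\<close>). In other words, after complementing \<open>t\<close> if necessary, every
  vertex of the 3-cube occurs in the columns \<open>abc\<close> of a row at which \<open>t\<close> equals the parity
  of \<open>abc\<close>. Hence \<open>t\<close> differs from that parity on a set \<open>D t\<close> of at most two rows, and
  likewise for \<open>u\<close> and \<open>w\<close>.

  After these complementations, two of the columns \<open>t, u, w\<close> can disagree only on the union of
  their exceptional sets. They must do so in both ways, and each way with both values of the third
  column, which needs four rows. So the sets \<open>D t\<close>, \<open>D u\<close>, \<open>D w\<close> have exactly two
  elements and are pairwise disjoint (\<open>exceptional_rows\<close>). There are then ten rows, and the eight
  rows outside any one of the sets show different vertices of the 3-cube in the columns \<open>abc\<close>.
  But any two rows lie outside one of three disjoint sets, so all ten rows show different vertices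
  of the 3-cube. This is absurd, since the cube has only eight.
\<close>

section \<open>Two-symbol arrays with at most ten rows\<close>

definition covers :: "'r set \<Rightarrow> ('r \<Rightarrow> bool) \<Rightarrow> ('r \<Rightarrow> bool) \<Rightarrow> ('r \<Rightarrow> bool) \<Rightarrow> bool" where
  "covers V x y z \<longleftrightarrow> (\<forall>p q r. \<exists>i\<in>V. x i = p \<and> y i = q \<and> z i = r)"

lemma covers_rotate:
  assumes "covers V x y z"
  shows "covers V y z x"
  unfolding covers_def
proof (intro allI)
  fix p q r
  obtain i where "i \<in> V" "x i = r" "y i = p" "z i = q"
    using assms[unfolded covers_def, rule_format, of r p q] by (elim bexE conjE)
  then show "\<exists>i\<in>V. y i = p \<and> z i = q \<and> x i = r"
    by (intro bexI[of _ i] conjI)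
qed

lemma covers_swap:
  assumes "covers V x y z"
  shows "covers V x z y"
  unfolding covers_def
proof (intro allI)
  fix p q r
  obtain i where "i \<in> V" "x i = p" "y i = r" "z i = q"
    using assms[unfolded covers_def, rule_format, of p r q] by (elim bexE conjE)
  then show "\<exists>i\<in>V. x i = p \<and> z i = q \<and> y i = r"
    by (intro bexI[of _ i] conjI)
qed

lemma sum_UNIV_prod: "(\<Sum>(x, y)\<in>UNIV. g x y) = (\<Sum>x\<in>UNIV. \<Sum>y\<in>UNIV. g x y)"
  by (simp add: sum.cartesian_product)

text \<open>
  Listing the two values of each coordinate from an arbitrary vector \<open>(P, Q, R, U)\<close> on lets the
  sixteen terms be compared with bounds that are stated relative to that vector.
\<close>

lemma sum_bool4:
  fixes m :: "bool \<Rightarrow> bool \<Rightarrow> bool \<Rightarrow> bool \<Rightarrow> nat"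
  shows "(\<Sum>(p, q, r, u)\<in>UNIV. m p q r u) =
    (\<Sum>p\<in>{P, \<not> P}. \<Sum>q\<in>{Q, \<not> Q}. \<Sum>r\<in>{R, \<not> R}. \<Sum>u\<in>{U, \<not> U}. m p q r u)"
proof -
  have UNIV_pair: "UNIV = {x, \<not> x}" for x :: bool
    by (cases x) auto
  show ?thesis
    unfolding UNIV_pair[symmetric] by (simp only: sum_UNIV_prod)
qed

text \<open>
  This is the case of \<open>parity_class_covered\<close> in which the two vectors that do not occur are at
  distance three. All their neighbours occur, which makes eight rows. The remaining six vectors can
  be matched into three disjoint edges of the cube, and each edge contains one more row.
\<close>

lemma missing_vectors_at_distance_3:
  assumes V: "finite V" "card V \<le> 10"
    and cov: "covers V a b c" "covers V a b t" "covers V a c t" "covers V b c t"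
    and x: "\<nexists>i. i \<in> V \<and> a i = P \<and> b i = Q \<and> c i = R \<and> t i = U"
    and y: "\<nexists>i. i \<in> V \<and> a i = (\<not> P) \<and> b i = (\<not> Q) \<and> c i = (\<not> R) \<and> t i = U"
  shows False
proof -
  define S where "S = (\<lambda>i. (a i, b i, c i, t i)) ` V"
  define m :: "bool \<Rightarrow> bool \<Rightarrow> bool \<Rightarrow> bool \<Rightarrow> nat"
    where "m p q r u = of_bool ((p, q, r, u) \<in> S)" for p q r u
  have "(\<Sum>(p, q, r, u)\<in>UNIV. m p q r u) = card S"
  proof -
    have "(\<Sum>(p, q, r, u)\<in>UNIV. m p q r u) = (\<Sum>v\<in>UNIV. of_bool (v \<in> S))"
      unfolding m_def by (intro sum.cong) auto
    also have "\<dots> = card S"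
      by (simp add: of_bool_def sum.If_cases)
    finally show ?thesis .
  qed
  also have "\<dots> \<le> 10"
    unfolding S_def using V card_image_le le_trans by blast
  finally have total: "(\<Sum>p\<in>{P, \<not> P}. \<Sum>q\<in>{Q, \<not> Q}. \<Sum>r\<in>{R, \<not> R}. \<Sum>u\<in>{U, \<not> U}. m p q r u) \<le> 10"
    by (subst (asm) sum_bool4[where P = P and Q = Q and R = R and U = U])
  have l1: "m p q r u + m p q r (\<not> u) \<ge> 1" for p q r u
  proof -
    obtain i where "i \<in> V" "a i = p" "b i = q" "c i = r"
      using cov(1) unfolding covers_def by blast
    then have "(p, q, r, t i) \<in> S"
      unfolding S_def by force
    then show ?thesis
      unfolding m_def by (cases "t i = u") auto
  qed
  have l2: "m p q r u + m p q (\<not> r) u \<ge> 1" for p q r u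
  proof -
    obtain i where "i \<in> V" "a i = p" "b i = q" "t i = u"
      using cov(2) unfolding covers_def by blast
    then have "(p, q, c i, u) \<in> S"
      unfolding S_def by force
    then show ?thesis
      unfolding m_def by (cases "c i = r") auto
  qed
  have l3: "m p q r u + m p (\<not> q) r u \<ge> 1" for p q r u
  proof -
    obtain i where "i \<in> V" "a i = p" "c i = r" "t i = u"
      using cov(3) unfolding covers_def by blast
    then have "(p, b i, r, u) \<in> S"
      unfolding S_def by force
    then show ?thesis
      unfolding m_def by (cases "b i = q") auto
  qed
  have l4: "m p q r u + m (\<not> p) q r u \<ge> 1" for p q r u
  proof -
    obtain i where "i \<in> V" "b i = q" "c i = r" "t i = u"
      using cov(4) unfolding covers_def by blast
    then have "(a i, q, r, u) \<in> S"
      unfolding S_def by force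
    then show ?thesis
      unfolding m_def by (cases "a i = p") auto
  qed
  have "m P Q R U = 0" "m (\<not> P) (\<not> Q) (\<not> R) U = 0"
    using x y unfolding m_def S_def by auto
  \<comment> \<open>The first eight bounds are the neighbours of the two vectors, the last three the matching.\<close>
  then show False
    using total
      l1[of P Q R U] l2[of P Q R U] l3[of P Q R U] l4[of P Q R U]
      l1[of "\<not> P" "\<not> Q" "\<not> R" U] l2[of "\<not> P" "\<not> Q" "\<not> R" U]
      l3[of "\<not> P" "\<not> Q" "\<not> R" U] l4[of "\<not> P" "\<not> Q" "\<not> R" U]
      l3[of "\<not> P" Q R "\<not> U"] l2[of P "\<not> Q" R "\<not> U"] l4[of P Q "\<not> R" "\<not> U"]
    by simp
qed

text \<open>
  On truth values \<open>p = (q = r)\<close> is the parity of \<open>p + q + r\<close>, and comparing with \<open>e\<close> keeps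
  or negates it. If the conclusion fails for both values of \<open>e\<close>, a vector of either parity does
  not occur. The distance of the two is odd. It is not one, as adjacent vectors agree in a covered
  triple; and it is not three by the previous lemma, whichever column the two vectors agree in.
\<close>

lemma parity_class_covered:
  assumes V: "finite V" "card V \<le> 10"
    and cov: "covers V a b c" "covers V a b t" "covers V a c t" "covers V b c t"
  shows "\<exists>e. \<forall>p q r. \<exists>i\<in>V. a i = p \<and> b i = q \<and> c i = r \<and> t i = (e = (p = (q = r)))"
    (is "\<exists>e. ?covered e")
proof (rule ccontr)
  assume "\<not> (\<exists>e. ?covered e)"
  then have "\<not> ?covered True" "\<not> ?covered False"
    by blast+
  then obtain p q r p' q' r' where
    x: "\<not> (\<exists>i\<in>V. a i = p \<and> b i = q \<and> c i = r \<and> t i = (True = (p = (q = r))))" and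
    y: "\<not> (\<exists>i\<in>V. a i = p' \<and> b i = q' \<and> c i = r' \<and> t i = (False = (p' = (q' = r'))))"
    by auto
  note d = missing_vectors_at_distance_3[OF V]
  have abct: False if "p' = (\<not> p)" "q' = (\<not> q)" "r' = (\<not> r)"
    by (rule d[OF cov, of p q r "p = (q = r)"]) (use x y that in blast)+
  have abtc: False if "p' = (\<not> p)" "q' = (\<not> q)" "r' = r"
    by (rule d[OF cov(2,1) cov(3,4)[THEN covers_swap], of p q "p = (q = r)" r])
      (use x y that in blast)+
  have actb: False if "p' = (\<not> p)" "q' = q" "r' = (\<not> r)"
    by (rule d[OF cov(3) cov(1)[THEN covers_swap] cov(2)[THEN covers_swap]
          cov(4)[THEN covers_rotate], of p r "p = (q = r)" q]) (use x y that in blast)+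
  have bcta: False if "p' = p" "q' = (\<not> q)" "r' = (\<not> r)"
    by (rule d[OF cov(4) cov(1-3)[THEN covers_rotate], of q r "p = (q = r)" p])
      (use x y that in blast)+
  have eq: False if "p' = p" "q' = q" "r' = r"
  proof -
    obtain i where "i \<in> V" "a i = p" "b i = q" "c i = r"
      using cov(1)[unfolded covers_def, rule_format, of p q r] by auto
    then show False
      using x y that by auto
  qed
  have ab_t: False if "p' = p" "q' = q" "r' = (\<not> r)"
  proof -
    obtain i where "i \<in> V" "a i = p" "b i = q" "t i = (p = (q = r))"
      using cov(2)[unfolded covers_def, rule_format, of p q "p = (q = r)"] by auto
    then show False
      using x y that by auto
  qed
  have ac_t: False if "p' = p" "r' = r" "q' = (\<not> q)"
  proof -
    obtain i where "i \<in> V" "a i = p" "c i = r" "t i = (p = (q = r))"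
      using cov(3)[unfolded covers_def, rule_format, of p r "p = (q = r)"] by auto
    then show False
      using x y that by auto
  qed
  have bc_t: False if "q' = q" "r' = r" "p' = (\<not> p)"
  proof -
    obtain i where "i \<in> V" "b i = q" "c i = r" "t i = (p = (q = r))"
      using cov(4)[unfolded covers_def, rule_format, of q r "p = (q = r)"] by auto
    then show False
      using x y that by auto
  qed
  show False
    using abct abtc actb bcta eq ab_t ac_t bc_t by blast
qed

text \<open>
  Here \<open>\<beta>\<close> stands for the vector in the three common columns and \<open>s\<close> for its parity. The rows
  at which \<open>x\<close> follows \<open>s\<close> show eight vectors, so at most two rows are exceptional for
  \<open>x\<close>, and likewise for \<open>y\<close>. On rows outside both exceptional sets, \<open>x\<close> and \<open>y\<close> are
  equal up to the sign \<open>d = e\<close>; the four combinations with the opposite sign and an arbitrary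
  value of \<open>z\<close> therefore occur on exceptional rows.
\<close>

lemma exceptional_rows:
  fixes \<beta> :: "'r \<Rightarrow> bool \<times> bool \<times> bool" and s :: "'r \<Rightarrow> bool"
  assumes V: "finite V" "card V \<le> 10"
    and x: "\<beta> ` {i\<in>V. x i = (d = s i)} = UNIV"
    and y: "\<beta> ` {i\<in>V. y i = (e = s i)} = UNIV"
    and cov: "covers V x y z"
  shows "card {i\<in>V. x i \<noteq> (d = s i)} = 2"
    and "{i\<in>V. x i \<noteq> (d = s i)} \<inter> {i\<in>V. y i \<noteq> (e = s i)} = {}"
proof -
  define D where "D = {i\<in>V. x i \<noteq> (d = s i)}"
  define E where "E = {i\<in>V. y i \<noteq> (e = s i)}"
  have le2: "card {i\<in>V. f i \<noteq> h i} \<le> 2" if "\<beta> ` {i\<in>V. f i = h i} = UNIV" for f h :: "'r \<Rightarrow> bool"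
  proof -
    have "card {i\<in>V. f i = h i} \<ge> card (\<beta> ` {i\<in>V. f i = h i})"
      using V by (intro card_image_le) auto
    then have "card {i\<in>V. f i = h i} \<ge> 8"
      unfolding that by (simp add: card_UNIV_bool flip: UNIV_Times_UNIV)
    moreover have "card ({i\<in>V. f i = h i} \<union> {i\<in>V. f i \<noteq> h i}) =
        card {i\<in>V. f i = h i} + card {i\<in>V. f i \<noteq> h i}"
      using V by (intro card_Un_disjoint) auto
    moreover have "{i\<in>V. f i = h i} \<union> {i\<in>V. f i \<noteq> h i} = V"
      by blast
    ultimately show ?thesis
      using V by simp
  qed
  have fin: "finite D" "finite E"
    unfolding D_def E_def using V by auto
  have "(\<lambda>i. (x i, z i)) ` (D \<union> E) = UNIV"
  proof -
    have "(p, r) \<in> (\<lambda>i. (x i, z i)) ` (D \<union> E)" for p r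
    proof -
      obtain i where i: "i \<in> V" "x i = p" "y i = (p \<noteq> (d = e))" "z i = r"
        using cov[unfolded covers_def, rule_format, of p "p \<noteq> (d = e)" r] by (elim bexE conjE)
      then have "i \<in> D \<union> E"
        unfolding D_def E_def by (cases "s i") auto
      then show ?thesis
        using i by (intro image_eqI[of _ _ i]) simp_all
    qed
    then show ?thesis
      by auto
  qed
  then have "card (D \<union> E) \<ge> 4"
    using card_image_le[of "D \<union> E" "\<lambda>i. (x i, z i)"] fin
    by (simp add: card_UNIV_bool flip: UNIV_Times_UNIV)
  moreover have "card D \<le> 2" "card E \<le> 2"
    unfolding D_def E_def using le2[OF x] le2[OF y] by simp_all
  moreover have "card D + card E = card (D \<union> E) + card (D \<inter> E)"
    using fin by (rule card_Un_Int)
  ultimately have "card D = 2" "card (D \<inter> E) = 0"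
    by linarith+
  then show "card {i\<in>V. x i \<noteq> (d = s i)} = 2"
    and "{i\<in>V. x i \<noteq> (d = s i)} \<inter> {i\<in>V. y i \<noteq> (e = s i)} = {}"
    using fin unfolding D_def E_def by auto
qed

text \<open>
  The sets \<open>G x e\<close> and \<open>D x e\<close> of the proof consist of the rows at which the column \<open>x\<close>
  follows the parity of the first three columns with sign \<open>e\<close>, and of the exceptional rows.
\<close>

lemma no_array_with_ten_rows:
  assumes V: "finite V" "card V \<le> 10"
    and abc: "covers V a b c"
    and t: "covers V a b t" "covers V a c t" "covers V b c t"
    and u: "covers V a b u" "covers V a c u" "covers V b c u"
    and w: "covers V a b w" "covers V a c w" "covers V b c w"
    and tuw: "covers V t u w"
  shows False
proof -
  define s where "s i = (a i = (b i = c i))" for i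
  define \<beta> where "\<beta> i = (a i, b i, c i)" for i
  define G where "G x e = {i\<in>V. x i = (e = s i)}" for x e
  define D where "D x e = {i\<in>V. x i \<noteq> (e = s i)}" for x e
  have good: "\<exists>e. \<beta> ` G x e = UNIV"
    if x: "covers V a b x" "covers V a c x" "covers V b c x" for x
  proof -
    obtain e where e: "\<And>p q r. \<exists>i\<in>V. a i = p \<and> b i = q \<and> c i = r \<and> x i = (e = (p = (q = r)))"
      using parity_class_covered[OF V abc x] by blast
    have "(p, q, r) \<in> \<beta> ` G x e" for p q r
      using e[of p q r] unfolding G_def \<beta>_def s_def by force
    then have "\<beta> ` G x e = UNIV"
      by auto
    then show ?thesis ..
  qed
  from good[OF t] good[OF u] good[OF w] obtain d e f where
    G: "\<beta> ` G t d = UNIV" "\<beta> ` G u e = UNIV" "\<beta> ` G w f = UNIV"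
    by metis
  note ex = exceptional_rows[OF V, where \<beta> = \<beta> and s = s, folded G_def D_def]
  have uwt: "covers V u w t" and wtu: "covers V w t u"
    using tuw covers_rotate by metis+
  have card_D: "card (D t d) = 2" "card (D u e) = 2" "card (D w f) = 2"
    using ex(1)[OF G(1,2) tuw] ex(1)[OF G(2,3) uwt] ex(1)[OF G(3,1) wtu] by auto
  have disj: "D t d \<inter> D u e = {}" "D u e \<inter> D w f = {}" "D w f \<inter> D t d = {}"
    using ex(2)[OF G(1,2) tuw] ex(2)[OF G(2,3) uwt] ex(2)[OF G(3,1) wtu] by auto
  have split: "V = G x h \<union> D x h" "G x h \<inter> D x h = {}" "finite (G x h)" "finite (D x h)" for x h
    unfolding G_def D_def using V by auto
  have cardV: "card V = card (G x h) + card (D x h)" for x h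
    using split[of x h] card_Un_disjoint by metis
  have UNIV8: "card (UNIV :: (bool \<times> bool \<times> bool) set) = 8"
    by (simp add: card_UNIV_bool flip: UNIV_Times_UNIV)
  have ge8: "card (G x h) \<ge> 8" if "\<beta> ` G x h = UNIV" for x h
    using card_image_le[OF split(3), of \<beta> x h] that UNIV8 by simp
  have inj: "inj_on \<beta> (G x h)" if "\<beta> ` G x h = UNIV" "card (D x h) = 2" for x h
  proof (rule eq_card_imp_inj_on[OF split(3)])
    show "card (\<beta> ` G x h) = card (G x h)"
      using that ge8[OF that(1)] cardV[of x h] V UNIV8 by simp
  qed
  have "inj_on \<beta> V"
  proof (rule inj_onI)
    fix i j
    assume ij: "i \<in> V" "j \<in> V" "\<beta> i = \<beta> j"
    \<comment> \<open>Each of the two rows is in at most one of the three disjoint exceptional sets.\<close>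
    have "{i, j} \<subseteq> G t d \<or> {i, j} \<subseteq> G u e \<or> {i, j} \<subseteq> G w f"
      using ij disj split(1)[of t d] split(1)[of u e] split(1)[of w f] by blast
    then show "i = j"
      using inj[OF G(1) card_D(1), THEN inj_onD, OF ij(3)]
        inj[OF G(2) card_D(2), THEN inj_onD, OF ij(3)]
        inj[OF G(3) card_D(3), THEN inj_onD, OF ij(3)] by auto
  qed
  then have "card V \<le> 8"
    using card_inj_on_le[of \<beta> V UNIV] UNIV8 by simp
  then show False
    using cardV[of t d] ge8[OF G(1)] card_D(1) by simp
qed

section \<open>Hyperedges and the columns of an array\<close>

definition bipartition :: "nat \<Rightarrow> nat set \<Rightarrow> nat set set" where
  "bipartition n P = {P, {1..n} - P}"

definition all_cells :: "nat \<Rightarrow> nat set \<Rightarrow> nat set \<Rightarrow> nat set \<Rightarrow> bool" where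
  "all_cells n P Q R \<longleftrightarrow>
    (\<forall>P'\<in>bipartition n P. \<forall>Q'\<in>bipartition n Q. \<forall>R'\<in>bipartition n R. P' \<inter> Q' \<inter> R' \<noteq> {})"

text \<open>
  Eight nonempty cells force the conditions on the vertices: each class contains four
  of the cells.
\<close>

lemma bipartition_in_QI3_verts:
  assumes P: "P \<subseteq> {1..n}" and cells: "all_cells n P Q R"
  shows "bipartition n P \<in> QI3_verts n"
proof -
  have large: "4 \<le> card P'" if P': "P' \<in> bipartition n P" for P'
  proof -
    have fin: "finite P'"
      using P' finite_subset[OF P finite_atLeastAtMost] unfolding bipartition_def by auto
    have "(\<lambda>i. (i \<in> Q, i \<in> R)) ` P' = UNIV"
    proof -
      have "(q, r) \<in> (\<lambda>i. (i \<in> Q, i \<in> R)) ` P'" for q r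
      proof -
        define Q' R' where "Q' = (if q then Q else {1..n} - Q)" and "R' = (if r then R else {1..n} - R)"
        have "Q' \<in> bipartition n Q" "R' \<in> bipartition n R"
          unfolding Q'_def R'_def bipartition_def by simp_all
        then have "P' \<inter> Q' \<inter> R' \<noteq> {}"
          using cells P' unfolding all_cells_def by simp
        then obtain i where "i \<in> P'" "i \<in> Q'" "i \<in> R'"
          by auto
        then show ?thesis
          unfolding Q'_def R'_def by (intro image_eqI[of _ _ i]) (simp_all split: if_splits)
      qed
      then show ?thesis
        by auto
    qed
    then show ?thesis
      using card_image_le[OF fin, of "\<lambda>i. (i \<in> Q, i \<in> R)"]
      by (simp add: card_UNIV_bool flip: UNIV_Times_UNIV)
  qed
  have "{} \<notin> bipartition n P"
    using large[of "{}"] by auto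
  then have ne: "P \<noteq> {}" "{1..n} - P \<noteq> {}"
    unfolding bipartition_def by blast+
  have "partition_on {1..n} (bipartition n P)"
    using P ne unfolding bipartition_def by (intro partition_onI) (auto simp: disjnt_def)
  moreover have "card (bipartition n P) = 2"
  proof -
    have "P \<noteq> {1..n} - P"
      using ne by blast
    then show ?thesis
      unfolding bipartition_def by simp
  qed
  ultimately show ?thesis
    using large unfolding QI3_verts_def by blast
qed

lemma bipartition_neq:
  assumes "all_cells n P Q R"
  shows "bipartition n P \<noteq> bipartition n Q"
proof
  assume eq: "bipartition n P = bipartition n Q"
  then have "{1..n} - P \<in> bipartition n Q"
    unfolding bipartition_def by blast
  moreover have "P \<in> bipartition n P" "R \<in> bipartition n R"
    unfolding bipartition_def by auto
  ultimately have "P \<inter> ({1..n} - P) \<inter> R \<noteq> {}"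
    using assms unfolding all_cells_def by blast
  then show False
    by auto
qed

lemma all_cells_rotate:
  assumes "all_cells n P Q R"
  shows "all_cells n Q R P"
  unfolding all_cells_def
proof (intro ballI)
  fix Q' R' P'
  assume "Q' \<in> bipartition n Q" "R' \<in> bipartition n R" "P' \<in> bipartition n P"
  then have "P' \<inter> Q' \<inter> R' \<noteq> {}"
    using assms unfolding all_cells_def by simp
  then show "Q' \<inter> R' \<inter> P' \<noteq> {}"
    by (simp add: Int_ac)
qed

lemma hyperedge_bipartition:
  assumes "P \<subseteq> {1..n}" "Q \<subseteq> {1..n}" "R \<subseteq> {1..n}" "all_cells n P Q R"
  shows "{bipartition n P, bipartition n Q, bipartition n R} \<in> hedges (QI3 n)"
proof -
  have 1: "all_cells n Q R P" and 2: "all_cells n R P Q"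
    using assms(4) all_cells_rotate by blast+
  have "bipartition n P \<in> QI3_verts n" "bipartition n Q \<in> QI3_verts n" "bipartition n R \<in> QI3_verts n"
    using bipartition_in_QI3_verts assms 1 2 by blast+
  moreover have "bipartition n P \<noteq> bipartition n Q" "bipartition n P \<noteq> bipartition n R"
    "bipartition n Q \<noteq> bipartition n R"
    using bipartition_neq[OF assms(4)] bipartition_neq[OF 1] bipartition_neq[OF 2] by auto
  ultimately show ?thesis
    using assms(4) unfolding QI3_def all_cells_def hypergraph.simps by blast
qed

text \<open>
  The three vertices of a hyperedge are distinct, so any three symbols prescribed for them form a
  tuple on the hyperedge.
\<close>

lemma covering_array_covers:
  fixes A :: "nat \<Rightarrow> nat set set \<Rightarrow> nat"
  assumes A: "covering_array {..<2} m (QI3 n) A"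
    and PQR: "P \<subseteq> {1..n}" "Q \<subseteq> {1..n}" "R \<subseteq> {1..n}" "all_cells n P Q R"
  shows "covers {..<m} (\<lambda>i. A i (bipartition n P) = 1) (\<lambda>i. A i (bipartition n Q) = 1)
    (\<lambda>i. A i (bipartition n R) = 1)"
  unfolding covers_def
proof (intro allI)
  fix p q r :: bool
  let ?X = "bipartition n P" and ?Y = "bipartition n Q" and ?Z = "bipartition n R"
  define t :: "nat set set \<Rightarrow> nat" where
    "t = (\<lambda>v\<in>{?X, ?Y, ?Z}. of_bool (if v = ?X then p else if v = ?Y then q else r))"
  have neq: "?X \<noteq> ?Y" "?X \<noteq> ?Z" "?Y \<noteq> ?Z"
    using bipartition_neq[OF PQR(4)] bipartition_neq[OF all_cells_rotate[OF PQR(4)]]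
      bipartition_neq[OF all_cells_rotate[OF all_cells_rotate[OF PQR(4)]]] by auto
  have "t \<in> {?X, ?Y, ?Z} \<rightarrow>\<^sub>E {..<2}"
    unfolding t_def by (auto simp: of_bool_def)
  then obtain i where "i < m" "\<forall>v\<in>{?X, ?Y, ?Z}. A i v = t v"
    using A hyperedge_bipartition[OF PQR] unfolding covering_array_def by meson
  then have "i < m" "A i ?X = of_bool p" "A i ?Y = of_bool q" "A i ?Z = of_bool r"
    using neq unfolding t_def by auto
  then show "\<exists>i\<in>{..<m}. (A i ?X = 1) = p \<and> (A i ?Y = 1) = q \<and> (A i ?Z = 1) = r"
    by (intro bexI[of _ i]) simp_all
qed

section \<open>The two bounds\<close>

text \<open>
  The row of index \<open>i\<close> belongs to the point \<open>i + 1\<close>, and the symbol \<open>0\<close> stands for the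
  class that contains the point \<open>1\<close>. The row that shows a given triple of symbols on a hyperedge
  is that of any point in the corresponding one of the eight cells.
\<close>

lemma covering_array_of_points:
  "covering_array {..<2 :: nat} n (QI3 n) (\<lambda>i X. of_bool (\<not> (\<exists>P\<in>X. 1 \<in> P \<and> Suc i \<in> P)))"
    (is "covering_array _ _ _ ?A")
proof -
  have side: "\<exists>P\<in>X. \<forall>i. Suc i \<in> P \<longrightarrow> ?A i X = k"
    if X: "X \<in> QI3_verts n" and k: "k < 2" for X and k :: nat
  proof -
    have part: "partition_on {1..n} X" and "card X = 2"
      using X unfolding QI3_verts_def by auto
    then obtain P Q where PQ: "X = {P, Q}" "P \<noteq> Q"
      by (auto simp: card_2_iff)
    have "P \<union> Q = {1..n}" and dis: "P \<inter> Q = {}" and "P \<noteq> {}"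
      using part PQ by (auto simp: partition_on_def disjoint_def)
    then have "1 \<in> P \<union> Q"
      by auto
    then obtain P' Q' where PQ': "X = {P', Q'}" "P' \<inter> Q' = {}" "1 \<in> P'"
      using PQ dis by blast
    have "k = 0 \<or> k = 1"
      using k by auto
    then show ?thesis
    proof
      assume "k = 0"
      then show ?thesis
        using PQ' by (intro bexI[of _ P']) auto
    next
      assume "k = 1"
      then show ?thesis
        using PQ' by (intro bexI[of _ Q']) auto
    qed
  qed
  have "\<exists>i<n. \<forall>v\<in>e. ?A i v = t v"
    if e: "e \<in> hedges (QI3 n)" and t: "t \<in> e \<rightarrow>\<^sub>E {..<2}" for e and t :: "nat set set \<Rightarrow> nat"
  proof -
    obtain X Y Z where XYZ: "e = {X, Y, Z}" "X \<in> QI3_verts n" "Y \<in> QI3_verts n" "Z \<in> QI3_verts n"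
      and cells: "\<forall>P\<in>X. \<forall>Q\<in>Y. \<forall>R\<in>Z. P \<inter> Q \<inter> R \<noteq> {}"
      using e unfolding QI3_def by auto
    have "t X < 2" "t Y < 2" "t Z < 2"
      using t XYZ(1) by auto
    then obtain P Q R where P: "P \<in> X" "\<forall>i. Suc i \<in> P \<longrightarrow> ?A i X = t X"
      and Q: "Q \<in> Y" "\<forall>i. Suc i \<in> Q \<longrightarrow> ?A i Y = t Y"
      and R: "R \<in> Z" "\<forall>i. Suc i \<in> R \<longrightarrow> ?A i Z = t Z"
      using side[OF XYZ(2)] side[OF XYZ(3)] side[OF XYZ(4)] by meson
    then obtain j where j: "j \<in> P" "j \<in> Q" "j \<in> R"
      using cells by blast
    moreover have "P \<subseteq> {1..n}"
      using XYZ(2) P(1) unfolding QI3_verts_def partition_on_def by auto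
    ultimately obtain i where i: "j = Suc i" "i < n"
      by (cases j) auto
    then have "?A i X = t X" "?A i Y = t Y" "?A i Z = t Z"
      using j P(2) Q(2) R(2) by blast+
    then show ?thesis
      unfolding XYZ(1) using i(2) by blast
  qed
  moreover have "?A i v \<in> {..<2}" for i v
    by simp
  ultimately show ?thesis
    unfolding covering_array_def by blast
qed

text \<open>
  The six sets are the columns of an array on the rows \<open>1, ..., 11\<close> that covers the eleven triples
  of \<open>no_array_with_ten_rows\<close>. So these triples are hyperedges, and the lemma excludes that a
  covering array with fewer rows covers them.
\<close>

lemma covering_array_11_rows_ge:
  fixes A :: "nat \<Rightarrow> nat set set \<Rightarrow> nat"
  assumes A: "covering_array {..<2} m (QI3 11) A"
  shows "11 \<le> m"
proof (rule ccontr)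
  assume "\<not> 11 \<le> m"
  then have V: "finite {..<m}" "card {..<m} \<le> 10"
    by auto
  define a b c t u w :: "nat set" where
    "a = {2, 4, 6, 8, 11}" and "b = {3, 4, 7, 8, 9}" and "c = {5, 6, 7, 8, 9, 11}" and
    "t = {4, 6, 7, 10}" and "u = {2, 3, 7, 8, 10, 11}" and "w = {2, 3, 5, 6, 7, 8}"
  have sub: "a \<subseteq> {1..11}" "b \<subseteq> {1..11}" "c \<subseteq> {1..11}" "t \<subseteq> {1..11}" "u \<subseteq> {1..11}" "w \<subseteq> {1..11}"
    unfolding a_def b_def c_def t_def u_def w_def by simp_all
  have abc: "all_cells 11 a b c"
    unfolding a_def b_def c_def by code_simp+
  have abx: "all_cells 11 a b t" "all_cells 11 a b u" "all_cells 11 a b w"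
    unfolding a_def b_def t_def u_def w_def by code_simp+
  have acx: "all_cells 11 a c t" "all_cells 11 a c u" "all_cells 11 a c w"
    unfolding a_def c_def t_def u_def w_def by code_simp+
  have bcx: "all_cells 11 b c t" "all_cells 11 b c u" "all_cells 11 b c w"
    unfolding b_def c_def t_def u_def w_def by code_simp+
  have tuw: "all_cells 11 t u w"
    unfolding t_def u_def w_def by code_simp+
  note cov = covering_array_covers[OF A]
  show False
    by (rule no_array_with_ten_rows[OF V])
      (rule cov[OF _ _ _ abc] cov[OF _ _ _ abx(1)] cov[OF _ _ _ acx(1)] cov[OF _ _ _ bcx(1)]
        cov[OF _ _ _ abx(2)] cov[OF _ _ _ acx(2)] cov[OF _ _ _ bcx(2)]
        cov[OF _ _ _ abx(3)] cov[OF _ _ _ acx(3)] cov[OF _ _ _ bcx(3)] cov[OF _ _ _ tuw] sub)+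
qed

theorem corollary1: "CAN (QI3 11) 2 = 11"
  unfolding CAN_def
proof (rule Least_equality)
  show "0 < (11 :: nat) \<and> (\<exists>A. covering_array {..<2 :: nat} 11 (QI3 11) A)"
    by (intro conjI exI) (simp, rule covering_array_of_points)
qed (use covering_array_11_rows_ge in blast)

end
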